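(* Let $\mathcal{N}=(P,T,F)$ be a Petri net and let $\langle M_0,Q\rangle$ be a slicing criterion for $\mathcal{N}$. If the minimal contributing slice algorithm (MinSlice), on input $\mathcal{N}$ and $\langle M_0,Q\rangle$, computes (returns) a net $\mathcal{N}'$, then $\mathcal{N}'$ is a minimal slice of $\mathcal{N}$ with respect to $\langle M_0,Q\rangle$.
   Context: **Petri nets.** A Petri net is $\mathcal{N}=(P,T,F)$ with $P$ (places) and $T$ (transitions) finite sets, $P\cap T=\emptyset$, $P\cup T\neq\emptyset$, and $F$ a flow relation assigning a weight in $\mathbb{N}\setminus\{0\}$ to each arc, the arcs being a subset of $(P\times T)\cup(T\times P)$ (weight $0$ = no arc). For a node $x$, ${}^\bullet x$ and $x^\bullet$ are the sets of nodes $y$ having an arc $(y,x)$, resp. $(x,y)$; for a set $X$ of nodes ${}^\bullet X=\bigcup_{x\in X}{}^\bullet x$. A marking is $M:P\to\mathbb{N}$. A transition $t$ is enabled in $M$ ($M\xrightarrow{t}$) iff $M(p)\ge F(p,t)$ for all $p\in{}^\bullet t$; firing it removes $F(p,t)$ tokens from each $p\in{}^\bullet t$ and adds $F(t,p')$ tokens to each $p'\in t^\bullet$ ($M\xrightarrow{t}M'$). A firing sequence is $\sigma=t_1\ldots t_n$ with $M_0\xrightarrow{t_1}M_1\cdots\xrightarrow{t_n}M_n$. $R(\mathcal{N},M_0)$ is the set of markings reachable from $M_0$. **Subnets.** $\mathcal{N}'=(P',T',F')$ is a subnet of $\mathcal{N}$ if it is a Petri net with $P'\subseteq P$, $T'\subseteq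 T$ and $F'=F|_{(P',T')}$, the restriction of $F$ to $(P'\times T')\cup(T'\times P')$. **Slicing criterion.** A pair $\langle M_0,Q\rangle$ with $M_0$ an (initial) marking of $\mathcal{N}$ and $Q\subseteq P$. **Increasing firing sequence** of $\mathcal{N}$ w.r.t. $\langle M_0,Q\rangle$: a firing sequence $\sigma=t_1\ldots t_n$, $M_0\xrightarrow{t_1}\cdots\xrightarrow{t_{n-1}}M_{n-1}\xrightarrow{t_n}M_n$, with $M_{n-1}(p)<M_n(p)$ for some $p\in Q$. For a subnet $\mathcal{N}'=(P',T',F')$, an increasing firing sequence in $\mathcal{N}'$ w.r.t. $\langle M_0,Q\rangle$ is one of $\mathcal{N}'$ started from $M_0|_{P'}$, with $p\in Q\cap P'$. **Subsequence.** $\sigma'$ is a subsequence of a firing sequence $\sigma$ w.r.t. a set of transitions $S$ if $\sigma'$ consists of all transition firings in $\sigma$ of transitions in $S$, in the same order. When $\sigma'$ is a firing sequence of a subnet $(P',T',F')$, "subsequence" is meant w.r.t. $S=T'$. **Slice.** $\mathcal{N}'=(P',T',F')$ is a slice of $\mathcal{N}$ w.r.t. $\langle M_0,Q\rangle$ if (1) it is a subnet of $\mathcal{N}$ such that for every $t\in T'$, every $p\in{}^\bullet t$ (preset in $\mathcal{N}$) lies in $P'$; and (2) there is an increasing firing sequence $\sigma'$ in $\mathcal{N}'$ w.r.t. $\langle M_0,Q\rangle$ that is a subsequence of some increasing firing sequence $\sigma$ in $\mathcal{N}$ w.r.t. $\langle M_0,Q\rangle$. **Minimal slice.** A slice $\mathcal{N}'=(P',T',F')$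 of $\mathcal{N}$ w.r.t. $\langle M_0,Q\rangle$ for which there is an increasing firing sequence $\sigma'=t'_1\ldots t'_n$ in $\mathcal{N}'$ w.r.t. $\langle M_0,Q\rangle$ such that $\mathcal{N}'$ only contains the places and transitions needed to fire $\sigma'$ (i.e. every transition in $T'$ occurs in $\sigma'$, and every place in $P'$ is an input place of some transition in $T'$ or is the place of $Q$ whose marking is increased by the last firing of $\sigma'$), and such that there is no slice $\mathcal{N}''$ of $\mathcal{N}$ w.r.t. $\langle M_0,Q\rangle$ having an increasing firing sequence $t''_1\ldots t''_m$ with $m<n$. **Algorithm MinSlice.** Input: $\mathcal{N}=(P,T,F)$, $\langle M_0,Q\rangle$. Step 1 (backward slice). $(P_b,T_b)=\mathsf{b\_slice}(Q,\emptyset)$, $\mathcal{N}_b=(P_b,T_b,F|_{(P_b,T_b)})$, where (presets in $\mathcal{N}$) $\mathsf{b\_slice}(\emptyset,W_{done})=(\emptyset,\emptyset)$ and, for $W\ne\emptyset$, choosing some $p\in W$ and putting $T_{in}={}^\bullet p$, $W'_{done}=W_{done}\cup\{p\}$, $$\mathsf{b\_slice}(W,W_{done})=(\{p\}\cup{}^\bullet T_{in},\,T_{in})\oplus\mathsf{b\_slice}((W\cup{}^\bullet T_{in})\setminus W'_{done},\,W'_{done}),$$ with $(A,B)\oplus(A',B')=(A\cup A',B\cup B')$. Step 2 (filter). Starting from $\mathcal{N}_b$, while the current net has a place $p$ with $M_0(p)=0$ and ${}^\bullet p=\emptyset$ (in the current net), remove $p$ and all transitions in $p^\bullet$ (restricting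 the flow relation accordingly). Call the result $\mathit{filteredBackwardSlice}$. Step 3 (forward slice). Let $\mathcal{N}_f=\mathsf{f\_slice}(\mathit{filteredBackwardSlice},\langle M_0|_{P_b},Q\rangle)$ with the marking restricted to the places of the net. If $\mathcal{N}_f=(\emptyset,\emptyset,\emptyset)$ return "no slice exists"; otherwise return $\mathcal{N}'=\mathcal{N}_f$. **Procedure $\mathsf{f\_slice}(\mathcal{N},\langle M_0,Q\rangle)$** for a net $\mathcal{N}=(P,T,F)$. If there is no $M_f\in R(\mathcal{N},M_0)$ with $M_0(p)<M_f(p)$ for some $p\in Q$, return $(\emptyset,\emptyset,\emptyset)$. Otherwise build a rooted tree whose nodes are (labelled by) reachable markings, with root $M_0$ and edges labelled by transitions. For a node $v$ and a transition $t$ enabled in $v$, let $w(v,t)=l(v)+l(t)$, where $l(v)$ is the number of edges on the tree path from the root to $v$ and $l(t)$ is the minimum number of transitions (including $t$) on a directed path in $\mathcal{N}$ from $t$ to some $q\in Q$ ($\infty$ if there is none). Initially the tree is just the root and $\mathit{enabledTransitions}=\{(M_0,t): M_0\xrightarrow{t}\}$. While $\mathit{enabledTransitions}\neq\emptyset$: choose and remove from it a pair $(v,t)$ of minimum weight $w(v,t)$ (ties broken arbitrarily); add to the tree a child $v'$ of $v$ along an edge labelled $t$, where $v\xrightarrow{t}v'$; if no proper ancestor of $v'$ carries the same marking as $v'$, add all pairs $(v',t')$ with $v'\xrightarrow{t'}$ to $\mathit{enabledTransitions}$; if $v'(p)>v(p)$ for some $p\in Q$, let $T'$ be the set of transitions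 labelling the tree path from the root to $v'$, let $P'=\{p\}\cup\bigcup_{t\in T'}{}^\bullet t$, and return $(P',T',F|_{(P',T')})$. *)

theory Defs
  imports "HOL-Library.FuncSet" "HOL-Library.Extended_Nat" "HOL-Library.Sublist"
begin

text \<open>
  Places and transitions share one node type, so that their disjointness is a condition on nets.
  The weight 0 means that there is no arc.
\<close>

record 'n net =
  places :: "'n set"
  transitions :: "'n set"
  flow :: "'n \<Rightarrow> 'n \<Rightarrow> nat"

definition petri_net :: "'n net \<Rightarrow> bool" where
  "petri_net N \<longleftrightarrow>
     finite (places N) \<and> finite (transitions N) \<and>
     places N \<inter> transitions N = {} \<and> places N \<union> transitions N \<noteq> {} \<and>
     (\<forall>x y. flow N x y > 0 \<longrightarrow>
        (x, y) \<in> places N \<times> transitions N \<union> transitions N \<times> places N)"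

definition preset :: "'n net \<Rightarrow> 'n \<Rightarrow> 'n set" where
  "preset N x = {y. flow N y x > 0}"

definition postset :: "'n net \<Rightarrow> 'n \<Rightarrow> 'n set" where
  "postset N x = {y. flow N x y > 0}"

text \<open>
  A marking of a net is a function that is \<^term>\<open>undefined\<close> outside the places; hence markings
  are equal as functions iff they agree on the places, and the restriction of a marking to fewer
  places is \<^const>\<open>restrict\<close>.
\<close>

type_synonym 'n marking = "'n \<Rightarrow> nat"

definition markings :: "'n net \<Rightarrow> 'n marking set" where
  "markings N = places N \<rightarrow>\<^sub>E UNIV"

definition enabled :: "'n net \<Rightarrow> 'n marking \<Rightarrow> 'n \<Rightarrow> bool" where
  "enabled N M t \<longleftrightarrow> t \<in> transitions N \<and> (\<forall>p\<in>preset N t. M p \<ge> flow N p t)"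

definition fire :: "'n net \<Rightarrow> 'n \<Rightarrow> 'n marking \<Rightarrow> 'n marking" where
  "fire N t M = (\<lambda>p. M p - flow N p t + flow N t p)"

definition fire_seq :: "'n net \<Rightarrow> 'n list \<Rightarrow> 'n marking \<Rightarrow> 'n marking" where
  "fire_seq N \<sigma> M = fold (fire N) \<sigma> M"

primrec firing_sequence :: "'n net \<Rightarrow> 'n marking \<Rightarrow> 'n list \<Rightarrow> bool" where
  "firing_sequence N M [] \<longleftrightarrow> True"
| "firing_sequence N M (t # \<sigma>) \<longleftrightarrow> enabled N M t \<and> firing_sequence N (fire N t M) \<sigma>"

definition reachable :: "'n net \<Rightarrow> 'n marking \<Rightarrow> 'n marking set" where
  "reachable N M0 = {fire_seq N \<sigma> M0 |\<sigma>. firing_sequence N M0 \<sigma>}"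

definition restrict_net :: "'n net \<Rightarrow> 'n set \<Rightarrow> 'n set \<Rightarrow> 'n net" where
  "restrict_net N P' T' =
     \<lparr>places = P', transitions = T',
      flow = (\<lambda>x y. if (x, y) \<in> P' \<times> T' \<union> T' \<times> P' then flow N x y else 0)\<rparr>"

definition subnet :: "'n net \<Rightarrow> 'n net \<Rightarrow> bool" where
  "subnet N' N \<longleftrightarrow>
     petri_net N' \<and> places N' \<subseteq> places N \<and> transitions N' \<subseteq> transitions N \<and>
     N' = restrict_net N (places N') (transitions N')"

definition slicing_criterion :: "'n net \<Rightarrow> 'n marking \<Rightarrow> 'n set \<Rightarrow> bool" where
  "slicing_criterion N M0 Q \<longleftrightarrow> M0 \<in> markings N \<and> Q \<subseteq> places N"

definition increasing_at ::
  "'n net \<Rightarrow> 'n marking \<Rightarrow> 'n set \<Rightarrow> 'n list \<Rightarrow> 'n \<Rightarrow> bool" where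
  "increasing_at N M0 Q \<sigma> p \<longleftrightarrow>
     \<sigma> \<noteq> [] \<and> firing_sequence N M0 \<sigma> \<and> p \<in> Q \<inter> places N \<and>
     fire_seq N (butlast \<sigma>) M0 p < fire_seq N \<sigma> M0 p"

definition increasing ::
  "'n net \<Rightarrow> 'n marking \<Rightarrow> 'n set \<Rightarrow> 'n list \<Rightarrow> bool" where
  "increasing N M0 Q \<sigma> \<longleftrightarrow> (\<exists>p. increasing_at N M0 Q \<sigma> p)"

definition slice :: "'n net \<Rightarrow> 'n marking \<Rightarrow> 'n set \<Rightarrow> 'n net \<Rightarrow> bool" where
  "slice N M0 Q N' \<longleftrightarrow>
     subnet N' N \<and>
     (\<forall>t\<in>transitions N'. preset N t \<subseteq> places N') \<and>
     (\<exists>\<sigma>' \<sigma>. increasing N' (restrict M0 (places N')) Q \<sigma>' \<and> increasing N M0 Q \<sigma> \<and>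
        \<sigma>' = filter (\<lambda>t. t \<in> transitions N') \<sigma>)"

text \<open>
  The last firing may increase several places of \<open>Q\<close>; only a single one of them, \<open>q\<close>, may
  belong to a minimal slice without being an input place of one of its transitions.
\<close>

definition minimal_slice :: "'n net \<Rightarrow> 'n marking \<Rightarrow> 'n set \<Rightarrow> 'n net \<Rightarrow> bool" where
  "minimal_slice N M0 Q N' \<longleftrightarrow>
     slice N M0 Q N' \<and>
     (\<exists>\<sigma>' q. increasing_at N' (restrict M0 (places N')) Q \<sigma>' q \<and>
        transitions N' \<subseteq> set \<sigma>' \<and>
        places N' \<subseteq> insert q (\<Union>t\<in>transitions N'. preset N' t) \<and>
        \<not> (\<exists>N'' \<sigma>''. slice N M0 Q N'' \<and>
             increasing N'' (restrict M0 (places N'')) Q \<sigma>'' \<and> length \<sigma>'' < length \<sigma>'))"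

text \<open>
  The algorithm makes arbitrary choices, so each of its parts is a relation between the input and
  the possible results. For \<open>b_slice N\<close> the arguments are \<open>W\<close>, the places already done, and the
  resulting places and transitions.
\<close>

inductive b_slice :: "'n net \<Rightarrow> 'n set \<Rightarrow> 'n set \<Rightarrow> 'n set \<Rightarrow> 'n set \<Rightarrow> bool"
  for N where
  b_slice_empty: "b_slice N {} Wdone {} {}"
| b_slice_choose:
    "\<lbrakk>p \<in> W; Tin = preset N p; Wdone' = Wdone \<union> {p}; Pin = (\<Union>t\<in>Tin. preset N t);
      b_slice N ((W \<union> Pin) - Wdone') Wdone' A B\<rbrakk>
     \<Longrightarrow> b_slice N W Wdone (({p} \<union> Pin) \<union> A) (Tin \<union> B)"

inductive filter_step :: "'n marking \<Rightarrow> 'n net \<Rightarrow> 'n net \<Rightarrow> bool"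
  for M0 where
  "\<lbrakk>p \<in> places N; M0 p = 0; preset N p = {}\<rbrakk>
   \<Longrightarrow> filter_step M0 N
         (restrict_net N (places N - {p}) (transitions N - postset N p))"

definition filter_result :: "'n marking \<Rightarrow> 'n net \<Rightarrow> 'n net \<Rightarrow> bool" where
  "filter_result M0 N N' \<longleftrightarrow> (filter_step M0)\<^sup>*\<^sup>* N N' \<and> \<not> (\<exists>N''. filter_step M0 N' N'')"

text \<open>The infimum of the empty set is \<open>\<infinity>\<close>.\<close>

definition distance :: "'n net \<Rightarrow> 'n set \<Rightarrow> 'n \<Rightarrow> enat" where
  "distance N Q t =
     (INF xs \<in> {xs. xs \<noteq> [] \<and> successively (\<lambda>x y. flow N x y > 0) xs \<and> hd xs = t \<and> last xs \<in> Q}.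
        enat (length (filter (\<lambda>x. x \<in> transitions N) xs)))"

text \<open>
  A pair \<open>(v, t)\<close> enters the set of enabled transitions only when the tree node \<open>v\<close> is created,
  and is removed when it is chosen. So the children of a node have distinct edge labels, and a node
  is represented by the list of edge labels on its path from the root \<open>[]\<close>: its marking is
  \<^term>\<open>fire_seq N v M0\<close>, its depth is the length of the list, and its proper ancestors are the
  strict prefixes of the list. A state consists of the tree nodes and the enabled transitions.
\<close>

type_synonym 'n node = "'n list"

type_synonym 'n state = "'n node set \<times> ('n node \<times> 'n) set"

definition weight :: "'n net \<Rightarrow> 'n set \<Rightarrow> 'n node \<Rightarrow> 'n \<Rightarrow> enat" where
  "weight N Q v t = enat (length v) + distance N Q t"

definition min_weight_pair ::
  "'n net \<Rightarrow> 'n set \<Rightarrow> ('n node \<times> 'n) set \<Rightarrow> 'n node \<Rightarrow> 'n \<Rightarrow> bool" where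
  "min_weight_pair N Q E v t \<longleftrightarrow>
     (v, t) \<in> E \<and> (\<forall>(u, s)\<in>E. weight N Q v t \<le> weight N Q u s)"

definition enabled_pairs :: "'n net \<Rightarrow> 'n marking \<Rightarrow> 'n node \<Rightarrow> ('n node \<times> 'n) set" where
  "enabled_pairs N M0 v = {(v, t) |t. enabled N (fire_seq N v M0) t}"

definition expand :: "'n net \<Rightarrow> 'n marking \<Rightarrow> 'n node \<Rightarrow> 'n \<Rightarrow> 'n state \<Rightarrow> 'n state" where
  "expand N M0 v t = (\<lambda>(V, E).
     let v' = v @ [t] in
     (insert v' V,
      (E - {(v, t)}) \<union>
        (if \<exists>u\<in>V. strict_prefix u v' \<and> fire_seq N u M0 = fire_seq N v' M0
         then {} else enabled_pairs N M0 v')))"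

inductive f_loop :: "'n net \<Rightarrow> 'n marking \<Rightarrow> 'n set \<Rightarrow> 'n state \<Rightarrow> 'n net \<Rightarrow> bool"
  for N M0 Q where
  f_loop_stop:
    "\<lbrakk>min_weight_pair N Q E v t; p \<in> Q \<inter> places N;
      fire_seq N (v @ [t]) M0 p > fire_seq N v M0 p;
      T' = set (v @ [t]); P' = {p} \<union> (\<Union>s\<in>T'. preset N s)\<rbrakk>
     \<Longrightarrow> f_loop N M0 Q (V, E) (restrict_net N P' T')"
| f_loop_continue:
    "\<lbrakk>min_weight_pair N Q E v t;
      \<not> (\<exists>p \<in> Q \<inter> places N. fire_seq N (v @ [t]) M0 p > fire_seq N v M0 p);
      f_loop N M0 Q (expand N M0 v t (V, E)) N'\<rbrakk>
     \<Longrightarrow> f_loop N M0 Q (V, E) N'"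

definition empty_net :: "'n net" where
  "empty_net = \<lparr>places = {}, transitions = {}, flow = (\<lambda>_ _. 0)\<rparr>"

definition f_slice :: "'n net \<Rightarrow> 'n marking \<Rightarrow> 'n set \<Rightarrow> 'n net \<Rightarrow> bool" where
  "f_slice N M0 Q N' \<longleftrightarrow>
     (if \<not> (\<exists>Mf \<in> reachable N M0. \<exists>p \<in> Q \<inter> places N. M0 p < Mf p)
      then N' = empty_net
      else f_loop N M0 Q ({[]}, enabled_pairs N M0 []) N')"

definition MinSlice_returns :: "'n net \<Rightarrow> 'n marking \<Rightarrow> 'n set \<Rightarrow> 'n net \<Rightarrow> bool" where
  "MinSlice_returns N M0 Q N' \<longleftrightarrow>
     (\<exists>Pb Tb filteredBackwardSlice.
        b_slice N Q {} Pb Tb \<and>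
        filter_result M0 (restrict_net N Pb Tb) filteredBackwardSlice \<and>
        f_slice filteredBackwardSlice (restrict M0 (places filteredBackwardSlice)) Q N' \<and>
        N' \<noteq> empty_net)"

end

theory Submission
  imports Defs
begin

text \<open>
  The forward slice is a best-first search, so the returned sequence is shortest provided that the
  weight never overestimates along some shortest increasing firing sequence. It can overestimate
  along other sequences, because a transition may be far from \<open>Q\<close> and yet be fired just before \<open>Q\<close>
  increases. In a shortest sequence, however, no firing can be dropped, so every firing but the last
  puts a token on an input place of a later one. Following these dependencies from a firing gives a
  path in the net to the increased place that visits at most as many transitions as there are
  firings left. The same path keeps the shortest sequences of the whole net inside the backward
  slice, and the filter only removes transitions that can never fire.
\<close>

section \<open>Increasing firing sequences\<close>

lemma fire_seq_append [simp]: "fire_seq N (u @ v) M = fire_seq N v (fire_seq N u M)"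
  by (simp add: fire_seq_def)

lemma fire_seq_Nil [simp]: "fire_seq N [] M = M"
  by (simp add: fire_seq_def)

lemma fire_seq_Cons [simp]: "fire_seq N (t # v) M = fire_seq N v (fire N t M)"
  by (simp add: fire_seq_def)

lemma firing_sequence_append [simp]:
  "firing_sequence N M (u @ v) \<longleftrightarrow> firing_sequence N M u \<and> firing_sequence N (fire_seq N u M) v"
  by (induction u arbitrary: M) auto

lemma firing_sequence_transitions: "firing_sequence N M \<sigma> \<Longrightarrow> set \<sigma> \<subseteq> transitions N"
  by (induction \<sigma> arbitrary: M) (auto simp: enabled_def)

lemma enabled_iff: "enabled N M t \<longleftrightarrow> t \<in> transitions N \<and> (\<forall>p. flow N p t \<le> M p)"
  unfolding enabled_def preset_def by (metis gr0I le0 mem_Collect_eq)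

text \<open>Enabledness makes the truncated subtraction in \<open>fire\<close> exact, so whether a
  place gains tokens depends on the two arc weights alone and not on the marking.\<close>

lemma fire_less_iff: "enabled N M t \<Longrightarrow> M p < fire N t M p \<longleftrightarrow> flow N p t < flow N t p"
  unfolding enabled_iff fire_def by (metis add_diff_inverse_nat add.commute leD nat_add_left_cancel_less)

lemma increasing_at_snoc:
  "increasing_at N M Q (v @ [t]) p \<longleftrightarrow>
     firing_sequence N M (v @ [t]) \<and> p \<in> Q \<inter> places N \<and> flow N p t < flow N t p"
  by (auto simp: increasing_at_def fire_less_iff)

lemma increasing_at_iff:
  "increasing_at N M Q \<sigma> p \<longleftrightarrow>
     \<sigma> \<noteq> [] \<and> firing_sequence N M \<sigma> \<and> p \<in> Q \<inter> places N \<and>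
     flow N p (last \<sigma>) < flow N (last \<sigma>) p"
proof (cases \<sigma> rule: rev_cases)
  case Nil
  then show ?thesis by (simp add: increasing_at_def)
next
  case (snoc v t)
  then show ?thesis by (simp only: increasing_at_snoc) simp
qed

lemma firing_sequence_mono:
  assumes "firing_sequence N M w" and "\<And>b p. b \<in> set w \<Longrightarrow> flow N p b > 0 \<Longrightarrow> M p \<le> M' p"
  shows "firing_sequence N M' w"
  using assms
proof (induction w arbitrary: M M')
  case Nil
  then show ?case by simp
next
  case (Cons t w)
  have "flow N p t \<le> M' p" for p
    using Cons.prems(1) Cons.prems(2)[of t p] unfolding firing_sequence.simps enabled_iff
    by (metis dual_order.trans gr0I le0 list.set_intros(1))
  then have "enabled N M' t"
    using Cons.prems(1) by (simp add: enabled_iff)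
  moreover have "firing_sequence N (fire N t M') w"
  proof (rule Cons.IH)
    show "firing_sequence N (fire N t M) w"
      using Cons.prems(1) by simp
    show "fire N t M p \<le> fire N t M' p" if "b \<in> set w" "flow N p b > 0" for b p
      using Cons.prems(2)[of b p] that by (simp add: fire_def diff_le_mono)
  qed
  ultimately show ?case by simp
qed

section \<open>Dependencies between the firings of a shortest increasing sequence\<close>

definition shortest_increasing ::
  "'n net \<Rightarrow> 'n marking \<Rightarrow> 'n set \<Rightarrow> 'n list \<Rightarrow> 'n \<Rightarrow> bool" where
  "shortest_increasing N M Q \<sigma> q \<longleftrightarrow>
     increasing_at N M Q \<sigma> q \<and> (\<forall>\<tau>. increasing N M Q \<tau> \<longrightarrow> length \<sigma> \<le> length \<tau>)"

lemma shortest_increasing_exists: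
  assumes "increasing N M Q \<rho>"
  obtains \<sigma> q where "shortest_increasing N M Q \<sigma> q" "length \<sigma> \<le> length \<rho>"
proof -
  obtain \<sigma> where "increasing N M Q \<sigma>" "\<forall>\<tau>. increasing N M Q \<tau> \<longrightarrow> length \<sigma> \<le> length \<tau>"
    using ex_has_least_nat[of "increasing N M Q" \<rho> length] assms by blast
  with assms that show thesis
    unfolding shortest_increasing_def increasing_def by blast
qed

text \<open>Otherwise \<open>a\<close> could be dropped: \<open>w\<close> would fire without it and
  end with the same firing, which gives a shorter increasing sequence.\<close>

lemma shortest_increasing_dependency:
  assumes "shortest_increasing N M Q (u @ a # w) q" and "w \<noteq> []"
  obtains b p where "b \<in> set w" "flow N a p > 0" "flow N p b > 0"
proof (rule ccontr)
  assume "\<not> thesis"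
  with that have indep: "flow N a p = 0" if "b \<in> set w" "flow N p b > 0" for b p
    using that by blast
  have inc: "increasing_at N M Q (u @ a # w) q"
    using assms(1) by (simp add: shortest_increasing_def)
  then have fs: "firing_sequence N M u"
      "firing_sequence N (fire N a (fire_seq N u M)) w"
    by (auto simp: increasing_at_def)
  \<comment> \<open>Since \<open>a\<close> produces nothing on the input places of \<open>w\<close>,
    the marking before \<open>a\<close> is at least as large there as the one after it.\<close>
  have "firing_sequence N (fire_seq N u M) w"
    using fs(2) by (rule firing_sequence_mono) (simp add: fire_def indep)
  with fs(1) inc assms(2) have "increasing_at N M Q (u @ w) q"
    by (simp add: increasing_at_iff)
  then have "length (u @ a # w) \<le> length (u @ w)"
    using assms(1) unfolding shortest_increasing_def increasing_def by blast
  then show False by simp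
qed

text \<open>Each dependency leads through one place to a strictly later firing, so the path meets at
  most one transition per firing from \<open>a\<close> onwards. Places are not counted.\<close>

lemma shortest_increasing_path:
  assumes "petri_net N" and "shortest_increasing N M Q (u @ a # w) q"
  shows "\<exists>xs. xs \<noteq> [] \<and> successively (\<lambda>x y. flow N x y > 0) xs \<and> hd xs = a \<and> last xs = q \<and>
    length (filter (\<lambda>x. x \<in> transitions N) xs) \<le> Suc (length w)"
  using assms(2)
proof (induction "length w" arbitrary: u a w rule: less_induct)
  case less
  have inc: "increasing_at N M Q (u @ a # w) q"
    using less.prems by (simp add: shortest_increasing_def)
  show ?case
  proof (cases "w = []")
    case True
    \<comment> \<open>The last firing increases \<open>q\<close>, so its arc to \<open>q\<close> has
      positive weight and \<open>[a, q]\<close> is a path that counts only \<open>a\<close>.\<close>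
    have "q \<notin> transitions N"
      using inc assms(1) by (auto simp: increasing_at_def petri_net_def)
    with inc True show ?thesis
      by (intro exI[of _ "[a, q]"]) (auto simp: increasing_at_iff)
  next
    case False
    obtain b p where b: "b \<in> set w" "flow N a p > 0" "flow N p b > 0"
      using shortest_increasing_dependency[OF less.prems False] .
    obtain x y where w: "w = x @ b # y"
      using b(1) by (meson split_list)
    have "b \<in> transitions N"
      using inc b(1) by (auto simp: increasing_at_def dest!: firing_sequence_transitions)
    then have "p \<notin> transitions N"
      using assms(1) b(3) unfolding petri_net_def by blast
    moreover have "shortest_increasing N M Q ((u @ a # x) @ b # y) q"
      using less.prems w by simp
    from less.hyps[OF _ this] obtain ys where "ys \<noteq> []" "successively (\<lambda>x y. flow N x y > 0) ys" "hd ys = b"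
        "last ys = q" "length (filter (\<lambda>x. x \<in> transitions N) ys) \<le> Suc (length y)"
      using w by auto
    ultimately show ?thesis
      using b w by (intro exI[of _ "a # p # ys"]) (auto simp: successively_Cons)
  qed
qed

text \<open>A loop \<open>x\<close> back to the same marking could be cut out, and the last firing
  survives because it lies in \<open>w\<close>. This is why pruning at repeated markings is harmless
  to shortest sequences.\<close>

lemma shortest_increasing_distinct_markings:
  assumes "shortest_increasing N M Q (u @ x @ w) q" and "w \<noteq> []"
    and "fire_seq N (u @ x) M = fire_seq N u M"
  shows "x = []"
proof -
  have "increasing_at N M Q (u @ w) q"
    using assms unfolding shortest_increasing_def increasing_at_iff by simp
  then have "length (u @ x @ w) \<le> length (u @ w)"
    using assms(1) unfolding shortest_increasing_def increasing_def by blast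
  then show ?thesis by simp
qed

section \<open>Subnets that contain the presets of their transitions\<close>

text \<open>Condition (1) of a slice, except that \<open>K\<close> may be the empty net, which
  backward slicing and filtering can produce and which is not a Petri net.\<close>

definition preset_closed_subnet :: "'n net \<Rightarrow> 'n net \<Rightarrow> bool" where
  "preset_closed_subnet N K \<longleftrightarrow>
     places K \<subseteq> places N \<and> transitions K \<subseteq> transitions N \<and>
     K = restrict_net N (places K) (transitions K) \<and>
     (\<forall>t\<in>transitions K. preset N t \<subseteq> places K)"

lemma preset_closed_subnetD:
  assumes "preset_closed_subnet N K"
  shows "places K \<subseteq> places N" "transitions K \<subseteq> transitions N"
    and "t \<in> transitions K \<Longrightarrow> preset N t \<subseteq> places K"
  using assms unfolding preset_closed_subnet_def by blast+

lemma restrict_net_simps [simp]: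
  "places (restrict_net N P T) = P"
  "transitions (restrict_net N P T) = T"
  "flow (restrict_net N P T) x y = (if (x, y) \<in> P \<times> T \<union> T \<times> P then flow N x y else 0)"
  by (simp_all add: restrict_net_def)

lemma restrict_net_restrict_net:
  "P' \<subseteq> P \<Longrightarrow> T' \<subseteq> T \<Longrightarrow> restrict_net (restrict_net N P T) P' T' = restrict_net N P' T'"
  by (auto simp: restrict_net_def fun_eq_iff)

lemma preset_closed_subnet_flow:
  assumes "preset_closed_subnet N K"
  shows "flow K x y =
    (if (x, y) \<in> places K \<times> transitions K \<union> transitions K \<times> places K then flow N x y else 0)"
  using assms restrict_net_simps(3) unfolding preset_closed_subnet_def by metis

text \<open>A place outside \<open>K\<close> has no arc to \<open>t\<close>, so the restriction can
  lose only output arcs of \<open>t\<close>.\<close>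

lemma preset_closed_subnet_flow_in:
  assumes "preset_closed_subnet N K" "t \<in> transitions K"
  shows "flow K p t = flow N p t"
proof (cases "p \<in> places K")
  case True
  with assms show ?thesis by (simp add: preset_closed_subnet_flow[OF assms(1)])
next
  case False
  with preset_closed_subnetD(3)[OF assms] have "flow N p t = 0"
    by (auto simp: preset_def)
  with False assms show ?thesis by (simp add: preset_closed_subnet_flow[OF assms(1)])
qed

lemma preset_closed_subnet_preset:
  "preset_closed_subnet N K \<Longrightarrow> t \<in> transitions K \<Longrightarrow> preset K t = preset N t"
  by (simp add: preset_def preset_closed_subnet_flow_in)

lemma preset_closed_subnet_trans:
  assumes "preset_closed_subnet N K" "preset_closed_subnet K L"
  shows "preset_closed_subnet N L"
proof -
  have "L = restrict_net N (places L) (transitions L)"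
    using assms restrict_net_restrict_net unfolding preset_closed_subnet_def by metis
  moreover have "preset N t \<subseteq> places L" if "t \<in> transitions L" for t
    using assms that preset_closed_subnet_preset[OF assms(1), of t]
    unfolding preset_closed_subnet_def by blast
  ultimately show ?thesis
    using assms unfolding preset_closed_subnet_def by blast
qed

lemma preset_closed_subnet_petri_net:
  assumes "petri_net N" "preset_closed_subnet N K" "places K \<union> transitions K \<noteq> {}"
  shows "petri_net K"
proof -
  have "finite (places K)" "finite (transitions K)"
    using assms(1) preset_closed_subnetD(1,2)[OF assms(2)]
    unfolding petri_net_def by (meson finite_subset)+
  moreover have "places K \<inter> transitions K = {}"
    using assms(1) preset_closed_subnetD(1,2)[OF assms(2)] unfolding petri_net_def by blast
  moreover have "\<forall>x y. flow K x y > 0 \<longrightarrow>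
      (x, y) \<in> places K \<times> transitions K \<union> transitions K \<times> places K"
    by (simp add: preset_closed_subnet_flow[OF assms(2)])
  ultimately show ?thesis
    using assms(3) unfolding petri_net_def by blast
qed

text \<open>Enabling in \<open>K\<close> tests all input places that \<open>N\<close> tests, and
  tokens that \<open>N\<close> puts outside \<open>K\<close> are never consulted by transitions of
  \<open>K\<close>. The two markings therefore have to agree only on the places of
  \<open>K\<close>.\<close>

lemma firing_sequence_preset_closed_subnet:
  assumes sub: "preset_closed_subnet N K" and "\<And>p. p \<in> places K \<Longrightarrow> M' p = M p"
  shows "firing_sequence K M' \<sigma> \<longleftrightarrow> firing_sequence N M \<sigma> \<and> set \<sigma> \<subseteq> transitions K"
  using assms(2)
proof (induction \<sigma> arbitrary: M M')
  case Nil
  then show ?case by simp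
next
  case (Cons t \<sigma>)
  show ?case
  proof (cases "t \<in> transitions K")
    case True
    have pre: "preset N t \<subseteq> places K" and "t \<in> transitions N"
      using preset_closed_subnetD[OF sub] True by blast+
    then have "enabled K M' t \<longleftrightarrow> enabled N M t"
      using True Cons.prems preset_closed_subnet_preset[OF sub True]
      by (simp add: enabled_def preset_closed_subnet_flow_in[OF sub True] subset_iff)
    moreover have "fire K t M' p = fire N t M p" if "p \<in> places K" for p
      using that True Cons.prems preset_closed_subnet_flow_in[OF sub True]
      by (simp add: fire_def preset_closed_subnet_flow[OF sub, of t p])
    then have "firing_sequence K (fire K t M') \<sigma> \<longleftrightarrow>
        firing_sequence N (fire N t M) \<sigma> \<and> set \<sigma> \<subseteq> transitions K"
      by (rule Cons.IH)
    ultimately show ?thesis using True by simp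
  next
    case False
    then show ?thesis by (simp add: enabled_def)
  qed
qed

lemma increasing_at_preset_closed_subnet:
  assumes "preset_closed_subnet N K"
  shows "increasing_at K (restrict M (places K)) Q \<sigma> p \<longleftrightarrow>
    increasing_at N M Q \<sigma> p \<and> set \<sigma> \<subseteq> transitions K \<and> p \<in> places K"
proof -
  have "firing_sequence K (restrict M (places K)) \<sigma> \<longleftrightarrow>
      firing_sequence N M \<sigma> \<and> set \<sigma> \<subseteq> transitions K"
    by (rule firing_sequence_preset_closed_subnet[OF assms]) simp
  moreover have "flow K p (last \<sigma>) = flow N p (last \<sigma>)" "flow K (last \<sigma>) p = flow N (last \<sigma>) p"
    if "\<sigma> \<noteq> []" "set \<sigma> \<subseteq> transitions K" "p \<in> places K"
  proof -
    have "last \<sigma> \<in> transitions K" using that by auto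
    with that show "flow K p (last \<sigma>) = flow N p (last \<sigma>)" "flow K (last \<sigma>) p = flow N (last \<sigma>) p"
      by (simp_all add: preset_closed_subnet_flow[OF assms])
  qed
  moreover have "places K \<subseteq> places N"
    using preset_closed_subnetD(1)[OF assms] .
  ultimately show ?thesis
    by (auto simp: increasing_at_iff)
qed

text \<open>An increasing sequence of \<open>K\<close> is itself one of \<open>N\<close> and uses
  only transitions of \<open>K\<close>, so it is its own subsequence and serves as both witnesses.
  The place that it increases makes \<open>K\<close> nonempty.\<close>

lemma slice_iff:
  assumes "petri_net N"
  shows "slice N M Q K \<longleftrightarrow>
    preset_closed_subnet N K \<and> (\<exists>\<sigma>. increasing K (restrict M (places K)) Q \<sigma>)"
proof
  assume "slice N M Q K"
  then show "preset_closed_subnet N K \<and> (\<exists>\<sigma>. increasing K (restrict M (places K)) Q \<sigma>)"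
    unfolding slice_def subnet_def preset_closed_subnet_def by blast
next
  assume "preset_closed_subnet N K \<and> (\<exists>\<sigma>. increasing K (restrict M (places K)) Q \<sigma>)"
  then obtain \<sigma> p where sub: "preset_closed_subnet N K"
      and inc: "increasing_at K (restrict M (places K)) Q \<sigma> p"
    by (auto simp: increasing_def)
  have inc_N: "increasing_at N M Q \<sigma> p" "set \<sigma> \<subseteq> transitions K"
    using inc increasing_at_preset_closed_subnet[OF sub] by auto
  have "places K \<union> transitions K \<noteq> {}"
    using inc by (auto simp: increasing_at_def)
  then have "subnet K N"
    using preset_closed_subnet_petri_net[OF assms sub] sub
    unfolding subnet_def preset_closed_subnet_def by blast
  moreover have "\<sigma> = filter (\<lambda>t. t \<in> transitions K) \<sigma>"
    using inc_N(2) by (metis filter_True subsetD)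
  ultimately show "slice N M Q K"
    using sub inc inc_N(1) unfolding slice_def preset_closed_subnet_def increasing_def by blast
qed

section \<open>Backward slice and filter\<close>

text \<open>Places in \<open>D\<close> are exempt because earlier calls have already contributed
  them and their presets. For \<open>D = {}\<close> this is full closure under presets.\<close>

lemma b_slice_closed:
  assumes "b_slice N W D A B"
  shows "W - D \<subseteq> A" "\<forall>p\<in>A - D. preset N p \<subseteq> B" "\<forall>t\<in>B. preset N t \<subseteq> A"
  using assms by (induction rule: b_slice.induct) auto

lemma b_slice_subset:
  assumes "b_slice N W D A B" "petri_net N" "W \<subseteq> places N"
  shows "A \<subseteq> places N \<and> B \<subseteq> transitions N"
  using assms
proof (induction rule: b_slice.induct)
  case (b_slice_empty Wdone)
  then show ?case by simp
next
  case (b_slice_choose p W Tin Wdone' Wdone Pin A B)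
  have "p \<in> places N"
    using b_slice_choose.hyps(1) b_slice_choose.prems(2) by blast
  with b_slice_choose.hyps(2) \<open>petri_net N\<close> have "Tin \<subseteq> transitions N"
    unfolding petri_net_def preset_def by blast
  moreover from this b_slice_choose.hyps(4) \<open>petri_net N\<close> have "Pin \<subseteq> places N"
    unfolding petri_net_def preset_def by blast
  ultimately show ?case
    using b_slice_choose.IH b_slice_choose.prems \<open>p \<in> places N\<close> by blast
qed

text \<open>Every firing has a dependency path to \<open>q\<close>; read backwards from
  \<open>q\<close>, it cannot leave a set that is closed under presets. Other increasing sequences
  may contain firings that are irrelevant to \<open>Q\<close>.\<close>

lemma shortest_increasing_in_backward_closed:
  assumes "petri_net N" "shortest_increasing N M Q \<sigma> q" "q \<in> A"
    and "\<forall>p\<in>A. preset N p \<subseteq> B" "\<forall>t\<in>B. preset N t \<subseteq> A" "A \<subseteq> places N" "B \<subseteq> transitions N"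
  shows "set \<sigma> \<subseteq> B"
proof
  fix a assume "a \<in> set \<sigma>"
  then obtain u w where \<sigma>: "\<sigma> = u @ a # w" by (meson split_list)
  then obtain xs where xs: "xs \<noteq> []" "successively (\<lambda>x y. flow N x y > 0) xs" "hd xs = a"
      "last xs = q"
    using shortest_increasing_path[OF assms(1)] assms(2) by metis
  from xs(1,2,4) have "hd xs \<in> A \<union> B"
  proof (induction xs rule: induct_list012)
    case (3 x y zs)
    then have "y \<in> A \<union> B" "x \<in> preset N y" by (auto simp: preset_def)
    with assms(4,5) show ?case by auto
  qed (use assms(3) in auto)
  moreover have "a \<in> transitions N"
    using assms(2) \<sigma> by (auto simp: shortest_increasing_def increasing_at_def enabled_def)
  ultimately show "a \<in> B"
    using xs(3) assms(1,6) by (auto simp: petri_net_def)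
qed

section \<open>Filtering places that stay empty\<close>

text \<open>Nothing produces on \<open>p\<close>, so it stays empty and no transition that consumes
  from it is ever enabled.\<close>

lemma firing_sequence_avoids_dead_place:
  assumes "firing_sequence N M \<sigma>" "M p = 0" "preset N p = {}"
  shows "set \<sigma> \<inter> postset N p = {}"
  using assms
proof (induction \<sigma> arbitrary: M)
  case Nil
  then show ?case by simp
next
  case (Cons t \<sigma>)
  have "flow N p t = 0" "flow N t p = 0"
    using Cons.prems by (auto simp: enabled_iff preset_def dest: spec[of _ p])
  moreover from this have "set \<sigma> \<inter> postset N p = {}"
    using Cons.prems by (intro Cons.IH[of "fire N t M"]) (simp_all add: fire_def)
  ultimately show ?case by (simp add: postset_def)
qed

text \<open>The transitions that consume from the removed place go with it, so no remaining
  transition misses an input place.\<close>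

lemma filter_step_closed:
  assumes sub: "preset_closed_subnet N K" and "filter_step M K K'"
  shows "preset_closed_subnet N K'"
  using assms(2)
proof cases
  case (1 p)
  have "K = restrict_net N (places K) (transitions K)"
    using sub unfolding preset_closed_subnet_def by blast
  then have K': "K' = restrict_net N (places K - {p}) (transitions K - postset K p)"
    using 1(1) restrict_net_restrict_net by (metis Diff_subset)
  have "preset N t \<subseteq> places K - {p}" if "t \<in> transitions K - postset K p" for t
    using that preset_closed_subnetD(3)[OF sub, of t] preset_closed_subnet_flow_in[OF sub, of t p]
    by (auto simp: postset_def preset_def)
  then show ?thesis
    using preset_closed_subnetD(1,2)[OF sub] unfolding preset_closed_subnet_def K' by auto
qed

lemma filter_step_increasing:
  assumes sub: "preset_closed_subnet N K" and step: "filter_step M K K'"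
    and inc: "increasing_at K (restrict M (places K)) Q \<sigma> q"
  shows "increasing_at K' (restrict M (places K')) Q \<sigma> q"
  using step
proof cases
  case (1 p)
  have K: "increasing_at N M Q \<sigma> q" "set \<sigma> \<subseteq> transitions K" "q \<in> places K"
    using inc increasing_at_preset_closed_subnet[OF sub] by auto
  have "set \<sigma> \<inter> postset K p = {}"
    using inc 1 firing_sequence_avoids_dead_place[of K "restrict M (places K)"]
    by (simp add: increasing_at_def)
  \<comment> \<open>The increased place has a producer, which the removed place lacks.\<close>
  moreover have "last \<sigma> \<in> preset K q"
    using inc by (auto simp: increasing_at_iff preset_def)
  with 1 have "q \<noteq> p" by auto
  ultimately show ?thesis
    using K 1 increasing_at_preset_closed_subnet[OF filter_step_closed[OF sub step]] by auto
qed

lemma filter_steps_increasing: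
  assumes "(filter_step M)\<^sup>*\<^sup>* K K'" "preset_closed_subnet N K"
  shows "preset_closed_subnet N K' \<and>
    (increasing_at K (restrict M (places K)) Q \<sigma> q \<longrightarrow>
     increasing_at K' (restrict M (places K')) Q \<sigma> q)"
  using assms
  by (induction rule: rtranclp_induct) (auto dest: filter_step_closed filter_step_increasing)

section \<open>Forward slice\<close>

text \<open>Each path starts at \<open>t\<close> and counts it; without a path the distance is
  \<open>\<infinity>\<close>.\<close>

lemma distance_ge_1:
  assumes "t \<in> transitions N"
  shows "1 \<le> distance N Q t"
  unfolding distance_def
proof (rule INF_greatest)
  fix xs assume "xs \<in> {xs. xs \<noteq> [] \<and> successively (\<lambda>x y. flow N x y > 0) xs \<and> hd xs = t \<and> last xs \<in> Q}"
  with assms show "1 \<le> enat (length (filter (\<lambda>x. x \<in> transitions N) xs))"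
    by (cases xs) (auto simp: one_enat_def)
qed

text \<open>The left side is the length of \<open>v @ [t]\<close>, the sequence that the search
  returns if it stops at this pair.\<close>

lemma weight_ge: "t \<in> transitions N \<Longrightarrow> enat (Suc (length v)) \<le> weight N Q v t"
  using add_left_mono[OF distance_ge_1, of t N "enat (length v)" Q]
  by (simp add: weight_def one_enat_def)

text \<open>Counterpart of \<open>weight_ge\<close>, and the admissibility of the search: the
  dependency path from \<open>a\<close> competes in the infimum and counts at most as many
  transitions as there are firings in \<open>a # w\<close>.\<close>

lemma weight_le_shortest_increasing:
  assumes "petri_net N" "shortest_increasing N M Q (u @ a # w) q"
  shows "weight N Q u a \<le> enat (length (u @ a # w))"
proof -
  obtain xs where xs: "xs \<noteq> []" "successively (\<lambda>x y. flow N x y > 0) xs" "hd xs = a" "last xs = q"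
      "length (filter (\<lambda>x. x \<in> transitions N) xs) \<le> Suc (length w)"
    using shortest_increasing_path[OF assms] by blast
  have "q \<in> Q"
    using assms(2) by (simp add: shortest_increasing_def increasing_at_def)
  with xs have "distance N Q a \<le> enat (length (filter (\<lambda>x. x \<in> transitions N) xs))"
    unfolding distance_def by (intro INF_lower) auto
  also have "\<dots> \<le> enat (Suc (length w))"
    using xs by simp
  finally show ?thesis
    using add_left_mono[of "distance N Q a" _ "enat (length u)"] by (fastforce simp: weight_def)
qed

text \<open>The search never loses a shortest sequence: one of its firings is always waiting in \<open>E\<close>.\<close>

lemma f_loop_result:
  assumes "f_loop N M Q S N'" and "petri_net N"
    and "\<forall>(v, t)\<in>snd S. firing_sequence N M (v @ [t])"
  shows "\<exists>\<rho> p. increasing_at N M Q \<rho> p \<and>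
    N' = restrict_net N ({p} \<union> (\<Union>s\<in>set \<rho>. preset N s)) (set \<rho>) \<and>
    (\<forall>u a w q. shortest_increasing N M Q (u @ a # w) q \<and> (u, a) \<in> snd S \<longrightarrow>
       length \<rho> \<le> length (u @ a # w))"
  using assms
proof (induction rule: f_loop.induct)
  case (f_loop_stop E v t p T' P' V)
  have fs: "firing_sequence N M (v @ [t])"
    using f_loop_stop by (auto simp: min_weight_pair_def)
  then have "increasing_at N M Q (v @ [t]) p"
    using f_loop_stop by (simp add: increasing_at_def)
  moreover have "length (v @ [t]) \<le> length (u @ a # w)"
    if "shortest_increasing N M Q (u @ a # w) q" "(u, a) \<in> E" for u a w q
  proof -
    \<comment> \<open>The length of the result is bounded by its weight, this by the weight of the
      waiting pair, and that by the length of the shortest sequence.\<close>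
    have "enat (Suc (length v)) \<le> weight N Q v t"
      using fs by (intro weight_ge) (simp add: enabled_def)
    also have "\<dots> \<le> weight N Q u a"
      using f_loop_stop.hyps(1) that(2) by (auto simp: min_weight_pair_def)
    also have "\<dots> \<le> enat (length (u @ a # w))"
      using weight_le_shortest_increasing[OF f_loop_stop.prems(1) that(1)] .
    finally show ?thesis by simp
  qed
  ultimately show ?case
    using f_loop_stop.hyps(4,5) by (intro exI[of _ "v @ [t]"] exI[of _ p]) auto
next
  case (f_loop_continue E v t V N')
  have fs: "firing_sequence N M (v @ [t])"
    using f_loop_continue by (auto simp: min_weight_pair_def)
  let ?S = "expand N M v t (V, E)"
  have "\<forall>(v, t)\<in>snd ?S. firing_sequence N M (v @ [t])"
    using f_loop_continue.prems(2) fs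
    by (auto simp: expand_def Let_def enabled_pairs_def split: if_splits)
  then obtain \<rho> p where \<rho>: "increasing_at N M Q \<rho> p"
      "N' = restrict_net N ({p} \<union> (\<Union>s\<in>set \<rho>. preset N s)) (set \<rho>)"
      and least: "\<And>u a w q. shortest_increasing N M Q (u @ a # w) q \<Longrightarrow> (u, a) \<in> snd ?S \<Longrightarrow>
        length \<rho> \<le> length (u @ a # w)"
    using f_loop_continue.IH[OF f_loop_continue.prems(1)] by blast
  have "length \<rho> \<le> length (u @ a # w)"
    if short: "shortest_increasing N M Q (u @ a # w) q" and "(u, a) \<in> E" for u a w q
  proof (cases "(u, a) = (v, t)")
    \<comment> \<open>Expansion removes only \<open>(v, t)\<close>, so this pair is still
      waiting.\<close>
    case False
    then show ?thesis
      using least[OF short] that(2) by (simp add: expand_def Let_def)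
  next
    case True
    have inc: "increasing_at N M Q (v @ t # w) q"
      using short True by (simp add: shortest_increasing_def)
    \<comment> \<open>If \<open>t\<close> were the last firing, it would increase \<open>q\<close>
      and the search would have stopped here.\<close>
    have "w \<noteq> []"
      using inc f_loop_continue.hyps(2) by (auto simp: increasing_at_def)
    then obtain b y where w: "w = b # y" by (cases w) auto
    \<comment> \<open>The new node is not pruned: an ancestor with the same marking would give a
      loop inside a shortest sequence.\<close>
    have "\<not> (strict_prefix r (v @ [t]) \<and> fire_seq N r M = fire_seq N (v @ [t]) M)" for r
    proof
      assume r: "strict_prefix r (v @ [t]) \<and> fire_seq N r M = fire_seq N (v @ [t]) M"
      then obtain x where x: "v @ [t] = r @ x" "x \<noteq> []"
        by (auto simp: strict_prefix_def prefix_def)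
      have "shortest_increasing N M Q (r @ x @ w) q"
        using short True x(1) by (metis append.assoc append_Cons append_Nil prod.inject)
      then show False
        using shortest_increasing_distinct_markings \<open>w \<noteq> []\<close> r x by metis
    qed
    then have "snd ?S = E - {(v, t)} \<union> enabled_pairs N M (v @ [t])"
      by (auto simp: expand_def Let_def)
    moreover have "(v @ [t], b) \<in> enabled_pairs N M (v @ [t])"
      using inc w by (simp add: increasing_at_def enabled_pairs_def)
    \<comment> \<open>The next firing \<open>b\<close> takes over as the waiting pair; the sequence
      is the same, split one position later.\<close>
    ultimately show ?thesis
      using least[of "v @ [t]" b y q] short True w by simp
  qed
  with \<rho> show ?case
    by (intro exI[of _ \<rho>] exI[of _ p]) auto
qed

section \<open>Combining backward slice, filter and forward search\<close>

theorem theorem3p9: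
  fixes N N' :: "'n net" and M0 :: "'n marking" and Q :: "'n set"
  assumes "petri_net N"
    and "slicing_criterion N M0 Q"
    and "MinSlice_returns N M0 Q N'"
  shows "minimal_slice N M0 Q N'"
proof -
  obtain Pb Tb K where b: "b_slice N Q {} Pb Tb"
      and filt: "(filter_step M0)\<^sup>*\<^sup>* (restrict_net N Pb Tb) K"
      and fsl: "f_slice K (restrict M0 (places K)) Q N'" and "N' \<noteq> empty_net"
    using assms(3) by (auto simp: MinSlice_returns_def filter_result_def)
  let ?M = "restrict M0 (places K)"
  have "Q \<subseteq> places N"
    using assms(2) by (simp add: slicing_criterion_def)
  note sub_b = b_slice_subset[OF b assms(1) this] and closed_b = b_slice_closed[OF b]
  have "preset_closed_subnet N (restrict_net N Pb Tb)"
    using sub_b closed_b by (simp add: preset_closed_subnet_def)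
  note Nb = this and filt' = filter_steps_increasing[OF filt this]
  then have K: "preset_closed_subnet N K" by blast
  note inc_K = increasing_at_preset_closed_subnet[OF K]
  have loop: "f_loop K ?M Q ({[]}, enabled_pairs K ?M []) N'"
    using fsl \<open>N' \<noteq> empty_net\<close> by (auto simp: f_slice_def split: if_splits)
  \<comment> \<open>A search that returns has first picked a transition enabled at the root.\<close>
  then have "places K \<union> transitions K \<noteq> {}"
    by (cases rule: f_loop.cases) (auto simp: min_weight_pair_def enabled_pairs_def enabled_def)
  then have pK: "petri_net K"
    using preset_closed_subnet_petri_net[OF assms(1) K] by blast
  obtain \<rho> p where \<rho>: "increasing_at K ?M Q \<rho> p"
      and N': "N' = restrict_net K ({p} \<union> (\<Union>s\<in>set \<rho>. preset K s)) (set \<rho>)"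
      and least: "\<And>u a w q. shortest_increasing K ?M Q (u @ a # w) q \<Longrightarrow>
        (u, a) \<in> enabled_pairs K ?M [] \<Longrightarrow> length \<rho> \<le> length (u @ a # w)"
  proof -
    have "\<forall>(v, t)\<in>snd ({[]}, enabled_pairs K ?M []). firing_sequence K ?M (v @ [t])"
      by (auto simp: enabled_pairs_def)
    from f_loop_result[OF loop pK this] show thesis
      unfolding snd_conv using that by blast
  qed
  \<comment> \<open>At the start, the first firing of every shortest sequence waits at the root
    \<open>[]\<close>.\<close>
  have shortest_K: "length \<rho> \<le> length \<sigma>" if "shortest_increasing K ?M Q \<sigma> q" for \<sigma> q
    using that least[of "[]" "hd \<sigma>" "tl \<sigma>" q]
    by (cases \<sigma>) (auto simp: shortest_increasing_def increasing_at_def enabled_pairs_def)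
  \<comment> \<open>A shortest sequence of \<open>N\<close> lies in the backward slice and survives
    the filter. It is shortest in \<open>K\<close> too, because increasing sequences of
    \<open>K\<close> are increasing in \<open>N\<close>.\<close>
  have shortest: "length \<rho> \<le> length \<tau>" if \<tau>: "increasing N M0 Q \<tau>" for \<tau>
  proof -
    obtain \<sigma> q where \<sigma>: "shortest_increasing N M0 Q \<sigma> q" and le: "length \<sigma> \<le> length \<tau>"
      using shortest_increasing_exists[OF \<tau>] .
    have inc: "increasing_at N M0 Q \<sigma> q"
      using \<sigma> by (simp add: shortest_increasing_def)
    then have "q \<in> Pb"
      using closed_b(1) by (auto simp: increasing_at_def)
    with \<sigma> have "set \<sigma> \<subseteq> Tb"
      using shortest_increasing_in_backward_closed[OF assms(1)] closed_b sub_b by (metis Diff_empty)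
    with inc \<open>q \<in> Pb\<close> have "increasing_at K ?M Q \<sigma> q"
      using filt' increasing_at_preset_closed_subnet[OF Nb] by simp
    moreover have "length \<sigma> \<le> length \<pi>" if "increasing K ?M Q \<pi>" for \<pi>
      using that \<sigma> inc_K unfolding shortest_increasing_def increasing_def by blast
    ultimately show ?thesis
      using shortest_K[of \<sigma> q] le by (auto simp: shortest_increasing_def)
  qed
  have "set \<rho> \<subseteq> transitions K" "p \<in> places K"
    using \<rho> inc_K by auto
  moreover have "preset K t \<subseteq> places K" if "t \<in> transitions K" for t
    using that preset_closed_subnetD(3)[OF K] preset_closed_subnet_preset[OF K] by simp
  ultimately have "preset_closed_subnet K N'"
    unfolding N' preset_closed_subnet_def by auto
  with K have N'_sub: "preset_closed_subnet N N'"
    by (rule preset_closed_subnet_trans)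
  \<comment> \<open>\<open>N'\<close> contains all transitions of \<open>\<rho>\<close> and the
    place \<open>p\<close>, so \<open>\<rho>\<close> is replayed in it unchanged.\<close>
  have \<rho>': "increasing_at N' (restrict M0 (places N')) Q \<rho> p"
    using \<rho> inc_K increasing_at_preset_closed_subnet[OF N'_sub] N' by simp
  have "preset N' t = preset K t" if "t \<in> set \<rho>" for t
    using that preset_closed_subnet_preset[OF \<open>preset_closed_subnet K N'\<close>] N' by simp
  then have "places N' \<subseteq> insert p (\<Union>t\<in>transitions N'. preset N' t)"
    unfolding N' by auto
  \<comment> \<open>Increasing sequences of any slice are increasing in \<open>N\<close>, so the
    bound for \<open>N\<close> covers all competing slices at once.\<close>
  moreover have "length \<rho> \<le> length \<sigma>"
    if "slice N M0 Q L" "increasing L (restrict M0 (places L)) Q \<sigma>" for L \<sigma>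
    using that shortest increasing_at_preset_closed_subnet[of N L]
    unfolding slice_iff[OF assms(1)] increasing_def by blast
  moreover have "slice N M0 Q N'"
    using slice_iff[OF assms(1)] N'_sub \<rho>' unfolding increasing_def by blast
  moreover have "transitions N' \<subseteq> set \<rho>"
    using N' by simp
  ultimately show ?thesis
    using \<rho>' unfolding minimal_slice_def by (meson not_le)
qed

end
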